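(* Let $n\geq 3$ and let $p=p_1p_2\cdots p_n$ range over the permutations of $\{1,\dots,n\}$. For each $i$ with $1\leq i\leq n-2$, the number of such permutations $p$ for which $p_i$ is a leaf of the minmax tree $T^m_p$ is $n!/3$. Moreover, $p_{n-1}$ is never a leaf of $T^m_p$, and $p_n$ is always a leaf of $T^m_p$.
   Context: For a word $w$ of distinct integers, its minmax tree $T^m_w$ is the binary tree defined recursively: if $w$ is empty the tree is empty; otherwise write $w=u\,m\,v$ where $m$ is the leftmost of the two letters of $w$ that are its minimum and its maximum (i.e. whichever of $\min w$, $\max w$ occurs first), $u$ is the subword before $m$ and $v$ the subword after $m$. Then $T^m_w$ has root $m$, left subtree $T^m_u$ and right subtree $T^m_v$. For a permutation $p$ of length $n$, the nodes of $T^m_p$ are the entries $p_1,\dots,p_n$; $p_i$ is a leaf if both its left and right subtrees are empty. *)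

theory Defs
  imports "HOL-Library.Tree" "HOL-Combinatorics.Multiset_Permutations"
begin

(* The constructor Leaf of the library's tree type is the empty tree; a leaf in the sense of the
   minmax tree is a node <Leaf, x, Leaf>.  hd and tl of the dropWhile below are the leftmost letter
   m that is the minimum or the maximum of w, and the subword after m.  In a one-letter word the
   minimum and the maximum coincide. *)

function minmax_tree :: "'a :: linorder list \<Rightarrow> 'a tree" where
  "minmax_tree w =
     (if w = [] then Leaf
      else let is_mid = (\<lambda>x. x \<noteq> Min (set w) \<and> x \<noteq> Max (set w));
               u = takeWhile is_mid w;
               mv = dropWhile is_mid w
           in Node (minmax_tree u) (hd mv) (minmax_tree (tl mv)))"
  by auto

termination
proof (relation "measure length", goal_cases)
  case 1
  show ?case by simp
next
  case (2 w p u mv)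
  have "Min (set w) \<in> set w" using 2(1) by simp
  then have "takeWhile p w \<noteq> w" using 2(2) by (metis takeWhile_eq_all_conv)
  then have "dropWhile p w \<noteq> []" by (auto simp: takeWhile_eq_all_conv dropWhile_eq_Nil_conv)
  moreover have "length (takeWhile p w) + length (dropWhile p w) = length w"
    by (metis length_append takeWhile_dropWhile_id)
  ultimately have "length (takeWhile p w) < length w"
    by (metis length_greater_0_conv less_add_same_cancel1)
  then show ?case using 2(3) by simp
next
  case (3 w p u mv)
  have "length (tl (dropWhile p w)) < length w"
    using 3(1) length_dropWhile_le[of p w]
    by (metis length_tl length_greater_0_conv diff_less less_one
        less_le_trans list.sel(2) nat_less_le)
  then show ?case using 3(4) by simp
qed

declare minmax_tree.simps [simp del]

definition is_leaf_of :: "'a \<Rightarrow> 'a tree \<Rightarrow> bool" where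
  "is_leaf_of x t \<longleftrightarrow> Node Leaf x Leaf \<in> subtrees t"

end

(* A node of a minmax tree with an empty right subtree is a leaf, because the extreme letter not
   chosen as a root lies to the right of the root.  Hence, for i <= n-2, the letter p_i is a leaf
   iff, when the recursion first separates the positions i, i+1, i+2, the root chosen is at i+1.
   Rotating the three letters p_i, p_(i+1), p_(i+2) cyclically does not affect the recursion before
   that step, and exactly one of the three rotations puts the first extreme letter at i+1. *)
theory Submission
  imports Defs
begin

section \<open>The recursion at the first extreme letter\<close>

definition extreme_in :: "'a :: linorder set \<Rightarrow> 'a \<Rightarrow> bool" where
  "extreme_in S x \<longleftrightarrow> x = Min S \<or> x = Max S"

lemma extreme_in_exists:
  assumes "w \<noteq> []"
  shows "\<exists>x\<in>set w. extreme_in (set w) x"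
  using assms by (auto simp: extreme_in_def intro!: bexI[of _ "Min (set w)"])

lemma minmax_tree_Nil [simp]: "minmax_tree [] = Leaf"
  by (simp add: minmax_tree.simps)

text \<open>Trades the \<open>takeWhile\<close>/\<open>dropWhile\<close> recursion for an explicit
  decomposition of the word; every root needed later is identified this way.\<close>

lemma minmax_tree_split:
  assumes "\<And>x. x \<in> set u \<Longrightarrow> \<not> extreme_in (set (u @ m # v)) x"
    and "extreme_in (set (u @ m # v)) m"
  shows "minmax_tree (u @ m # v) = Node (minmax_tree u) m (minmax_tree v)"
proof -
  define mid where "mid = (\<lambda>x. x \<noteq> Min (set (u @ m # v)) \<and> x \<noteq> Max (set (u @ m # v)))"
  have u: "\<And>x. x \<in> set u \<Longrightarrow> mid x" and m: "\<not> mid m"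
    using assms by (auto simp: mid_def extreme_in_def)
  have "takeWhile mid (u @ m # v) = u" "dropWhile mid (u @ m # v) = m # v"
    using u m by (simp_all add: takeWhile_append2 dropWhile_append2)
  then show ?thesis
    by (subst minmax_tree.simps) (simp only: mid_def[symmetric] Let_def, simp)
qed

lemma minmax_tree_eq_Leaf_iff [simp]: "minmax_tree w = Leaf \<longleftrightarrow> w = []"
  by (subst minmax_tree.simps) (simp add: Let_def)

lemma extreme_split_first:
  assumes "\<exists>x\<in>set w. extreme_in S x"
  obtains u m v where "w = u @ m # v" "extreme_in S m" "\<And>x. x \<in> set u \<Longrightarrow> \<not> extreme_in S x"
  using split_list_first_prop[OF assms] by blast

lemma set_minmax_tree [simp]: "set_tree (minmax_tree w) = set w"
proof (induction "length w" arbitrary: w rule: less_induct)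
  case less
  show ?case
  proof (cases "w = []")
    case False
    from extreme_in_exists[OF this] obtain u m v where
      "w = u @ m # v" "extreme_in (set w) m" "\<And>x. x \<in> set u \<Longrightarrow> \<not> extreme_in (set w) x"
      by (rule extreme_split_first) blast
    then show ?thesis using less[of u] less[of v] minmax_tree_split[of u m v] by simp
  qed simp
qed

section \<open>Leaves at the last two positions\<close>

lemma is_leaf_of_Node:
  "is_leaf_of x (Node l m r) \<longleftrightarrow>
     (x = m \<and> l = Leaf \<and> r = Leaf) \<or> is_leaf_of x l \<or> is_leaf_of x r"
  by (auto simp: is_leaf_of_def)

lemma is_leaf_of_Leaf [simp]: "\<not> is_leaf_of x Leaf"
  by (simp add: is_leaf_of_def)

lemma is_leaf_of_imp_mem: "is_leaf_of x t \<Longrightarrow> x \<in> set_tree t"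
  by (induction t) (auto simp: is_leaf_of_Node)

text \<open>In a word of distinct letters each letter lies in only one subword at a root, or is the
  root; this rules out the subtrees that miss it.\<close>

lemma not_is_leaf_of_minmax_tree: "x \<notin> set w \<Longrightarrow> \<not> is_leaf_of x (minmax_tree w)"
  using is_leaf_of_imp_mem[of x "minmax_tree w"] by auto

text \<open>\<open>Min S\<close> and \<open>Max S\<close> are themselves extreme, so both equal
  \<open>x\<close> and squeeze every element onto it. Consequently a word of at least two distinct
  letters has an extreme letter before its last one.\<close>

lemma eq_if_only_extreme:
  assumes "finite S" "y \<in> S" and "\<And>z. z \<in> S \<Longrightarrow> extreme_in S z \<Longrightarrow> z = x"
  shows "y = x"
proof -
  have "S \<noteq> {}" using assms(2) by auto
  then have "Min S = x" "Max S = x" using assms by (auto simp: extreme_in_def)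
  then show ?thesis using Min_le[of S y] Max_ge[of S y] assms by auto
qed

text \<open>A root inside \<open>u\<close> leaves \<open>x\<close> at the end of the right subword,
  where induction applies. If no letter of \<open>u\<close> is extreme, the word is
  \<open>[x]\<close> alone.\<close>

lemma last_is_leaf_of_minmax_tree:
  assumes "distinct (u @ [x])"
  shows "is_leaf_of x (minmax_tree (u @ [x]))"
  using assms
proof (induction "length u" arbitrary: u rule: less_induct)
  case less
  let ?E = "extreme_in (set (u @ [x]))"
  show ?case
  proof (cases "\<exists>y\<in>set u. ?E y")
    case True
    then obtain u1 m u2 where
      u: "u = u1 @ m # u2" "?E m" "\<And>y. y \<in> set u1 \<Longrightarrow> \<not> ?E y"
      by (rule extreme_split_first) blast
    then have "minmax_tree (u @ [x]) = Node (minmax_tree u1) m (minmax_tree (u2 @ [x]))"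
      using minmax_tree_split[of u1 m "u2 @ [x]"] by simp
    then show ?thesis using less(1)[of u2] less(2) u(1) by (simp add: is_leaf_of_Node)
  next
    case False
    have "y = x" if "y \<in> set (u @ [x])" for y
      by (rule eq_if_only_extreme[OF _ that]) (use False in auto)
    with less(2) have "u = []" by (cases u) auto
    then show ?thesis using minmax_tree_split[of "[]" x "[]"]
      by (simp add: extreme_in_def is_leaf_of_Node)
  qed
qed

text \<open>A root inside \<open>u\<close> leaves \<open>x, y\<close> at the end of the right
  subword. Otherwise \<open>x\<close> is the root, since \<open>y\<close> cannot be the only extreme
  letter, and its right subtree contains \<open>y\<close>.\<close>

lemma penultimate_not_is_leaf_of_minmax_tree:
  assumes "distinct (u @ [x, y])"
  shows "\<not> is_leaf_of x (minmax_tree (u @ [x, y]))"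
  using assms
proof (induction "length u" arbitrary: u rule: less_induct)
  case less
  let ?E = "extreme_in (set (u @ [x, y]))"
  show ?case
  proof (cases "\<exists>z\<in>set u. ?E z")
    case True
    then obtain u1 m u2 where
      u: "u = u1 @ m # u2" "?E m" "\<And>z. z \<in> set u1 \<Longrightarrow> \<not> ?E z"
      by (rule extreme_split_first) blast
    then have "minmax_tree (u @ [x, y]) = Node (minmax_tree u1) m (minmax_tree (u2 @ [x, y]))"
      using minmax_tree_split[of u1 m "u2 @ [x, y]"] by simp
    then show ?thesis using less(1)[of u2] less(2) u(1)
      by (auto simp: is_leaf_of_Node not_is_leaf_of_minmax_tree)
  next
    case False
    have "?E x"
    proof (rule ccontr)
      assume not_extreme: "\<not> ?E x"
      have "z = y" if "z \<in> set (u @ [x, y])" "?E z" for z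
        using that(1) not_extreme False that(2) by auto
      then have "x = y" by (rule eq_if_only_extreme[of "set (u @ [x, y])", rotated 2]) simp_all
      then show False using less(2) by simp
    qed
    then have "minmax_tree (u @ [x, y]) = Node (minmax_tree u) x (minmax_tree [y])"
      using False by (intro minmax_tree_split) auto
    then show ?thesis using less(2)
      by (auto simp: is_leaf_of_Node not_is_leaf_of_minmax_tree)
  qed
qed

section \<open>Rotating three consecutive letters\<close>

text \<open>The hypotheses place the root among \<open>x\<close>, \<open>y\<close>,
  \<open>z\<close>. A root \<open>x\<close> has \<open>y\<close> in its right subtree; a root
  \<open>y\<close> leaves \<open>x\<close> last in the left subword, hence a leaf; a root
  \<open>z\<close> leaves \<open>x\<close> next to last there, hence not a leaf.\<close>

lemma is_leaf_of_minmax_tree_separating: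
  fixes u v :: "'a :: linorder list" and x y z :: 'a
  defines "S \<equiv> set (u @ x # y # z # v)"
  assumes "distinct (u @ x # y # z # v)" and "\<And>t. t \<in> set u \<Longrightarrow> \<not> extreme_in S t"
    and "extreme_in S x \<or> extreme_in S y \<or> extreme_in S z"
  shows "is_leaf_of x (minmax_tree (u @ x # y # z # v)) \<longleftrightarrow> \<not> extreme_in S x \<and> extreme_in S y"
proof -
  consider "extreme_in S x" | "\<not> extreme_in S x" "extreme_in S y"
    | "\<not> extreme_in S x" "\<not> extreme_in S y" "extreme_in S z"
    using assms(4) by blast
  then show ?thesis
  proof cases
    case 1
    then have "minmax_tree (u @ x # y # z # v) = Node (minmax_tree u) x (minmax_tree (y # z # v))"
      using assms(3) by (intro minmax_tree_split) (auto simp: S_def)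
    then show ?thesis using 1 assms(2)
      by (auto simp: is_leaf_of_Node not_is_leaf_of_minmax_tree)
  next
    case 2
    then have "minmax_tree ((u @ [x]) @ y # z # v) =
        Node (minmax_tree (u @ [x])) y (minmax_tree (z # v))"
      using assms(3) by (intro minmax_tree_split) (auto simp: S_def)
    then show ?thesis using 2 assms(2) last_is_leaf_of_minmax_tree[of u x]
      by (auto simp: is_leaf_of_Node)
  next
    case 3
    then have "minmax_tree ((u @ [x, y]) @ z # v) =
        Node (minmax_tree (u @ [x, y])) z (minmax_tree v)"
      using assms(3) by (intro minmax_tree_split) (auto simp: S_def)
    then show ?thesis using 3 assms(2) penultimate_not_is_leaf_of_minmax_tree[of u x y]
      by (auto simp: is_leaf_of_Node not_is_leaf_of_minmax_tree)
  qed
qed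

text \<open>The three words have the same letters, hence the same extreme letters. A first extreme
  letter outside the triple is thus their common root, and the triple passes intact into a subword
  with a shorter \<open>u\<close> or \<open>v\<close>.\<close>

lemma exactly_one_rotation_is_leaf:
  assumes "distinct (u @ a # b # c # v)"
  shows "of_bool (is_leaf_of a (minmax_tree (u @ a # b # c # v)))
       + of_bool (is_leaf_of b (minmax_tree (u @ b # c # a # v)))
       + of_bool (is_leaf_of c (minmax_tree (u @ c # a # b # v))) = (1 :: nat)"
  using assms
proof (induction "length u + length v" arbitrary: u v rule: less_induct)
  case less
  define S where "S = set (u @ a # b # c # v)"
  let ?E = "extreme_in S"
  have S: "set (u @ b # c # a # v) = S" "set (u @ c # a # b # v) = S"
    by (auto simp: S_def)
  have dist: "distinct (u @ b # c # a # v)" "distinct (u @ c # a # b # v)"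
    using less(2) by auto
  consider "\<exists>x\<in>set u. ?E x" | "\<forall>x\<in>set u. \<not> ?E x" "?E a \<or> ?E b \<or> ?E c"
    | "\<forall>x\<in>set (u @ [a, b, c]). \<not> ?E x"
    by auto
  then show ?case
  proof cases
    case 1
    then obtain u1 m u2 where
      u: "u = u1 @ m # u2" "?E m" "\<And>x. x \<in> set u1 \<Longrightarrow> \<not> ?E x"
      by (rule extreme_split_first) blast
    \<comment> \<open>Kept general in \<open>x\<close>, \<open>y\<close>, \<open>z\<close> so that
      all three rotations are instances.\<close>
    have "is_leaf_of x (minmax_tree (u @ x # y # z # v)) \<longleftrightarrow>
          is_leaf_of x (minmax_tree (u2 @ x # y # z # v))"
      if "set (u @ x # y # z # v) = S" "distinct (u @ x # y # z # v)" for x y z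
    proof -
      have "minmax_tree (u @ x # y # z # v) =
            Node (minmax_tree u1) m (minmax_tree (u2 @ x # y # z # v))"
        using minmax_tree_split[of u1 m "u2 @ x # y # z # v"] u that(1) by simp
      then show ?thesis using that(2) u(1)
        by (auto simp: is_leaf_of_Node not_is_leaf_of_minmax_tree)
    qed
    then show ?thesis using less(1)[of u2 v] less(2) S dist S_def u(1) by simp
  next
    case 2
    have leaf_iff: "is_leaf_of x (minmax_tree (u @ x # y # z # v)) \<longleftrightarrow> \<not> ?E x \<and> ?E y"
      if "set (u @ x # y # z # v) = S" "distinct (u @ x # y # z # v)" "{x, y, z} = {a, b, c}"
      for x y z
    proof -
      have "?E x \<or> ?E y \<or> ?E z" using 2(2) that(3) by (metis insert_iff empty_iff)
      then show ?thesis
        using is_leaf_of_minmax_tree_separating[of u x y z v] that(1,2) 2(1) by simp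
    qed
    \<comment> \<open>Only two values can be extreme, so one or two of the three distinct letters
      are. Going around the cycle \<open>a\<close>, \<open>b\<close>, \<open>c\<close>, exactly one
      non-extreme letter is then followed by an extreme one.\<close>
    have "\<not> (?E a \<and> ?E b \<and> ?E c)"
      using less(2) by (auto simp: extreme_in_def)
    moreover have "is_leaf_of a (minmax_tree (u @ a # b # c # v)) \<longleftrightarrow> \<not> ?E a \<and> ?E b"
      "is_leaf_of b (minmax_tree (u @ b # c # a # v)) \<longleftrightarrow> \<not> ?E b \<and> ?E c"
      "is_leaf_of c (minmax_tree (u @ c # a # b # v)) \<longleftrightarrow> \<not> ?E c \<and> ?E a"
      by (rule leaf_iff; use S dist less(2) S_def in auto)+
    ultimately show ?thesis using 2(2) by auto
  next
    case 3
    obtain x where "x \<in> S" "?E x"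
      using extreme_in_exists[of "u @ a # b # c # v"] by (auto simp: S_def)
    \<comment> \<open>The root lies beyond the triple, so the left subword keeps \<open>u\<close>
      and the triple and only cuts \<open>v\<close> down to \<open>v1\<close>.\<close>
    with 3 have "\<exists>x\<in>set v. ?E x" by (auto simp: S_def)
    then obtain v1 m v2 where
      v: "v = v1 @ m # v2" "?E m" "\<And>x. x \<in> set v1 \<Longrightarrow> \<not> ?E x"
      by (rule extreme_split_first) blast
    have "is_leaf_of x (minmax_tree (u @ x # y # z # v)) \<longleftrightarrow>
          is_leaf_of x (minmax_tree (u @ x # y # z # v1))"
      if "set (u @ x # y # z # v) = S" "distinct (u @ x # y # z # v)" "{x, y, z} = {a, b, c}"
      for x y z
    proof -
      have "\<not> ?E t" if "t \<in> {x, y, z}" for t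
        using 3 that \<open>{x, y, z} = {a, b, c}\<close> by auto
      then have "minmax_tree ((u @ x # y # z # v1) @ m # v2) =
            Node (minmax_tree (u @ x # y # z # v1)) m (minmax_tree v2)"
        using v 3 that(1) by (intro minmax_tree_split) auto
      then show ?thesis using that(2) v(1)
        by (auto simp: is_leaf_of_Node not_is_leaf_of_minmax_tree)
    qed
    note leaf_iff = this
    have rotations: "is_leaf_of a (minmax_tree (u @ a # b # c # v)) \<longleftrightarrow>
            is_leaf_of a (minmax_tree (u @ a # b # c # v1))"
      "is_leaf_of b (minmax_tree (u @ b # c # a # v)) \<longleftrightarrow>
            is_leaf_of b (minmax_tree (u @ b # c # a # v1))"
      "is_leaf_of c (minmax_tree (u @ c # a # b # v)) \<longleftrightarrow>
            is_leaf_of c (minmax_tree (u @ c # a # b # v1))"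
      by (rule leaf_iff; use S dist less(2) S_def in auto)+
    show ?thesis
      unfolding rotations by (rule less(1)) (use less(2) v(1) in auto)
  qed
qed

section \<open>Counting by means of the rotation\<close>

definition rotate3_at :: "nat \<Rightarrow> 'a list \<Rightarrow> 'a list" where
  "rotate3_at k p = take k p @ rotate1 (take 3 (drop k p)) @ drop (k + 3) p"

lemma rotate3_at_append [simp]:
  "length u = k \<Longrightarrow> rotate3_at k (u @ a # b # c # v) = u @ b # c # a # v"
  by (auto simp: rotate3_at_def numeral_3_eq_3)

lemma split_at_triple:
  assumes "k + 3 \<le> length p"
  obtains u a b c v where "p = u @ a # b # c # v" "length u = k"
proof -
  have "p = take k p @ p ! k # p ! (k + 1) # p ! (k + 2) # drop (k + 3) p"
    using assms id_take_nth_drop[of k p] Cons_nth_drop_Suc[of "k + 1" p]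
      Cons_nth_drop_Suc[of "k + 2" p] by (simp add: numeral_3_eq_3)
  then show ?thesis using that assms by (metis add_leD1 length_take min.absorb2)
qed

text \<open>Three applications restore the word, so applying the rotation twice is its
  inverse.\<close>

lemma bij_betw_rotate3_at:
  assumes "k + 3 \<le> card A"
  shows "bij_betw (rotate3_at k) (permutations_of_set A) (permutations_of_set A)"
proof -
  have "rotate3_at k p \<in> permutations_of_set A \<and>
        rotate3_at k (rotate3_at k (rotate3_at k p)) = p"
    if "p \<in> permutations_of_set A" for p
  proof -
    have "k + 3 \<le> length p"
      using that assms by (auto simp: permutations_of_set_def distinct_card)
    then obtain u a b c v where "p = u @ a # b # c # v" "length u = k"
      by (rule split_at_triple)
    then show ?thesis using that by (auto simp: permutations_of_set_def)
  qed
  then show ?thesis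
    by (intro bij_betw_byWitness[where f' = "rotate3_at k \<circ> rotate3_at k"]) auto
qed

text \<open>Double counting: each permutation and its two rotations contribute exactly one leaf at
  position \<open>k\<close>, and the three resulting sums over all permutations agree.\<close>

lemma card_leaf_position:
  fixes A :: "'a :: linorder set"
  assumes "k + 3 \<le> card A"
  shows "3 * card {p \<in> permutations_of_set A. is_leaf_of (p ! k) (minmax_tree p)} = fact (card A)"
proof -
  let ?P = "permutations_of_set A" and ?r = "rotate3_at k"
  define f :: "'a list \<Rightarrow> nat" where "f p = of_bool (is_leaf_of (p ! k) (minmax_tree p))" for p
  \<comment> \<open>An infinite set has \<open>card\<close> 0, so the assumption forces
    finiteness.\<close>
  have fin: "finite A" using assms by (intro card_ge_0_finite) simp
  have bij: "bij_betw ?r ?P ?P" using assms by (rule bij_betw_rotate3_at)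
  have one: "f p + f (?r p) + f (?r (?r p)) = 1" if "p \<in> ?P" for p
  proof -
    have p: "distinct p" "k + 3 \<le> length p"
      using that assms by (auto simp: permutations_of_set_def distinct_card)
    from p(2) obtain u a b c v where "p = u @ a # b # c # v" "length u = k"
      by (rule split_at_triple)
    \<comment> \<open>Position \<open>k\<close> holds \<open>a\<close>, \<open>b\<close>,
      \<open>c\<close> in \<open>p\<close> and its successive rotations.\<close>
    then show ?thesis using exactly_one_rotation_is_leaf[of u a b c v] p(1)
      by (auto simp: f_def nth_append)
  qed
  have shift: "(\<Sum>p\<in>?P. g (?r p)) = sum g ?P" for g :: "'a list \<Rightarrow> nat"
    using sum.reindex_bij_betw[OF bij] .
  have "sum f ?P = card {p \<in> ?P. is_leaf_of (p ! k) (minmax_tree p)}"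
    unfolding f_def by (simp add: Int_def)
  moreover have "fact (card A) = (\<Sum>p\<in>?P. f p + f (?r p) + f (?r (?r p)))"
    using one fin by simp
  \<comment> \<open>Reindexing along the bijection turns the third sum into the second and the
    second into the first.\<close>
  moreover have "\<dots> = 3 * sum f ?P"
    using shift[of f] shift[of "\<lambda>p. f (?r p)"] by (simp add: sum.distrib)
  ultimately show ?thesis by simp
qed

theorem mainTheorem2:
  fixes n :: nat
  assumes "n \<ge> 3"
  shows "(\<forall>i\<in>{1..n-2}.
            real (card {p \<in> permutations_of_set {1..n}. is_leaf_of (p ! (i - 1)) (minmax_tree p)})
              = fact n / 3)
       \<and> (\<forall>p\<in>permutations_of_set {1..n}. \<not> is_leaf_of (p ! (n - 2)) (minmax_tree p))
       \<and> (\<forall>p\<in>permutations_of_set {1..n}. is_leaf_of (p ! (n - 1)) (minmax_tree p))"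
proof (intro conjI ballI)
  fix i assume "i \<in> {1..n-2}"
  \<comment> \<open>List positions start at 0: with \<open>k = i - 1\<close>, the bound
    \<open>i \<le> n - 2\<close> becomes \<open>k + 3 \<le> n\<close>.\<close>
  then have "3 * card {p \<in> permutations_of_set {1..n}. is_leaf_of (p ! (i - 1)) (minmax_tree p)}
      = fact n"
    using card_leaf_position[of "i - 1" "{1..n}"] assms by auto
  from arg_cong[OF this, of real]
  show "real (card {p \<in> permutations_of_set {1..n}. is_leaf_of (p ! (i - 1)) (minmax_tree p)})
      = fact n / 3"
    by simp
next
  fix p assume "p \<in> permutations_of_set {1..n}"
  then have p: "distinct p" "length p = n"
    using distinct_card[of p] by (auto simp: permutations_of_set_def)
  \<comment> \<open>Splitting at \<open>n - 3\<close> exposes the last three letters and forces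
    \<open>v\<close> to be empty.\<close>
  have "(n - 3) + 3 \<le> length p" using p(2) assms by simp
  then obtain u a b c v where *: "p = u @ a # b # c # v" "length u = n - 3"
    by (rule split_at_triple)
  from p(2) *(1) have "length u + 3 + length v = n" by auto
  then have "length v = 0" using *(2) assms by linarith
  with *(1) have p_eq: "p = (u @ [a]) @ [b, c]" by simp
  have "p ! (n - 2) = b" "p ! (n - 1) = c"
    using *(2) assms p_eq by (auto simp: nth_append nth_Cons')
  then show "\<not> is_leaf_of (p ! (n - 2)) (minmax_tree p)"
    and "is_leaf_of (p ! (n - 1)) (minmax_tree p)"
    using penultimate_not_is_leaf_of_minmax_tree[of "u @ [a]" b c]
      last_is_leaf_of_minmax_tree[of "u @ [a, b]" c] p(1) p_eq by auto
qed

end
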